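(* Let $\mathcal H$ be an $r$-uniform hypergraph (with $r\ge 2$) with at least one edge and let $p$ be a prime number with $r\leq p\leq\omega(\mathcal H)$. Let $t=\mathrm{Xind}_{\mathbb Z_p}(\mathrm{Hom}(K^r_p,\mathcal H))+p$. If $t=ap+b$, where $a$ and $b$ are nonnegative integers and $0\leq b\leq p-1$, then $$\chi_l(\mathcal H)\geq\min\left(\left\lceil\frac{(p-r+1)a+\min\{p-r+1,b\}}{r-1}\right\rceil+1,\ \left\lceil\frac{t}{r-1}\right\rceil\right).$$
   Context: A hypergraph $\mathcal H$ has a finite vertex set $V(\mathcal H)$ and an edge set $E(\mathcal H)$ which is a family of nonempty subsets of $V(\mathcal H)$; it is $r$-uniform if all edges have size $r$. $K^r_n=([n],\binom{[n]}{r})$, and $\omega(\mathcal H)$ is the largest $n$ such that $\mathcal H$ contains $K^r_n$ as a subhypergraph. A proper coloring is a map on $V(\mathcal H)$ with no monochromatic edge. Local chromatic number. For $X\subseteq V(\mathcal H)$, let $\mathcal N(X)=\{v\in V(\mathcal H):\exists e\in E(\mathcal H)\text{ with } e\setminus X=\{v\}\}$ and let the closed neighborhood be $\mathcal N[X]=X\cup\mathcal N(X)$. For a uniform hypergraph, $\chi_l(\mathcal H)=\min_c\max\{|c(\mathcal N[e\setminus\{v\}])|: e\in E(\mathcal H),\ v\in e\}$, the minimum over all proper colorings $c$ of $\mathcal H$ (with any number of colors). For pairwise disjoint $U_1,\dots,U_p\subseteq V(\mathcal H)$, $\mathcal H[U_1,\dots,U_p]$ is the hypergraph with vertex set $\bigcup_i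 U_i$ and edge set $\{e\in E(\mathcal H): e\subseteq\bigcup_iU_i,\ |e\cap U_i|\leq 1\ \forall i\in[p]\}$; it is a complete $r$-uniform $p$-partite hypergraph if it contains every $r$-subset of $\bigcup_iU_i$ meeting each $U_i$ in at most one vertex. Cross-index. $\mathbb Z_p=\{\omega^1,\dots,\omega^p\}$ is the cyclic group of order $p$ with generator $\omega$. A $\mathbb Z_p$-poset is a poset on which $\mathbb Z_p$ acts by order automorphisms; it is free if non-identity elements have no fixed points. $Q_{n,p}$ is the free $\mathbb Z_p$-poset on $\mathbb Z_p\times[n+1]$ with $(\epsilon,i)<(\epsilon',j)$ iff $i<j$ and action $\epsilon\cdot(\epsilon',j)=(\epsilon\epsilon',j)$. $\mathrm{Xind}_{\mathbb Z_p}(P)$ is the least $n$ such that there is an order-preserving $\mathbb Z_p$-equivariant map $P\to Q_{n,p}$. Hom complex. $\mathrm{Hom}(K^r_p,\mathcal H)$ is the free $\mathbb Z_p$-poset of all ordered $p$-tuples $(U_1,\dots,U_p)$ of nonempty pairwise disjoint subsets of $V(\mathcal H)$ such that $\mathcal H[U_1,\dots,U_p]$ is a complete $r$-uniform $p$-partite hypergraph, ordered by $(U_1,\dots,U_p)\preceq(U'_1,\dots,U'_p)$ iff $U_i\subseteq U'_i$ for all $i$, with action $\omega^i\cdot(U_1,\dots,U_p)=(U_{1+i},\dots,U_{p+i})$, where $U_j=U_{j-p}$ for $j>p$. *)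

theory Defs
  imports
    Complex_Main
    "HOL-Computational_Algebra.Primes"
    "HOL-Algebra.Group_Action"
    "HOL-Algebra.Elementary_Groups"
begin

section \<open>Hypergraphs\<close>

record 'a hgraph =
  verts :: "'a set"
  edges :: "'a set set"

definition hypergraph :: "'a hgraph \<Rightarrow> bool" where
  "hypergraph H \<longleftrightarrow> finite (verts H) \<and> (\<forall>e\<in>edges H. e \<noteq> {} \<and> e \<subseteq> verts H)"

definition uniform :: "nat \<Rightarrow> 'a hgraph \<Rightarrow> bool" where
  "uniform r H \<longleftrightarrow> (\<forall>e\<in>edges H. card e = r)"

definition complete_hgraph :: "nat \<Rightarrow> nat \<Rightarrow> nat hgraph" where
  "complete_hgraph r n = \<lparr>verts = {1..n}, edges = {e. e \<subseteq> {1..n} \<and> card e = r}\<rparr>"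

text \<open>\<open>H\<close> contains a (not necessarily induced) copy of \<open>K\<close>.\<close>

definition contains_copy :: "'a hgraph \<Rightarrow> 'b hgraph \<Rightarrow> bool" where
  "contains_copy H K \<longleftrightarrow>
     (\<exists>f. inj_on f (verts K) \<and> f ` verts K \<subseteq> verts H \<and> (\<forall>e\<in>edges K. f ` e \<in> edges H))"

text \<open>The set below contains 0, and is bounded by the number of vertices.\<close>

definition clique_number :: "nat \<Rightarrow> 'a hgraph \<Rightarrow> nat" where
  "clique_number r H = Max {n. contains_copy H (complete_hgraph r n)}"

section \<open>Local chromatic number\<close>

text \<open>As vertex sets are finite, colors in \<open>nat\<close> allow every possible coloring up to renaming
  of colors.\<close>

definition proper_coloring :: "'a hgraph \<Rightarrow> ('a \<Rightarrow> nat) \<Rightarrow> bool" where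
  "proper_coloring H c \<longleftrightarrow> (\<forall>e\<in>edges H. \<not> (\<exists>k. \<forall>v\<in>e. c v = k))"

definition nbhd :: "'a hgraph \<Rightarrow> 'a set \<Rightarrow> 'a set" where
  "nbhd H X = {v \<in> verts H. \<exists>e\<in>edges H. e - X = {v}}"

definition closed_nbhd :: "'a hgraph \<Rightarrow> 'a set \<Rightarrow> 'a set" where
  "closed_nbhd H X = X \<union> nbhd H X"

definition max_local_colors :: "'a hgraph \<Rightarrow> ('a \<Rightarrow> nat) \<Rightarrow> nat" where
  "max_local_colors H c = Max {card (c ` closed_nbhd H (e - {v})) | e v. e \<in> edges H \<and> v \<in> e}"

text \<open>The infimum of a nonempty set of natural numbers is its minimum; proper colorings exist as
  soon as all edges have at least two vertices.\<close>

definition local_chromatic_number :: "'a hgraph \<Rightarrow> nat" where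
  "local_chromatic_number H = (INF c \<in> {c. proper_coloring H c}. max_local_colors H c)"

section \<open>Free cyclic group posets and the cross-index\<close>

text \<open>The cyclic group of order \<open>p\<close> is \<open>integer_mod_group p\<close>, written additively on
  \<open>{0..<int p}\<close>: the residue \<open>i\<close> stands for the \<open>i\<close>-th power of the generator.\<close>

locale Zp_poset = group_action "integer_mod_group p" P \<phi>
  for p :: nat and P :: "'b set" and \<phi> :: "int \<Rightarrow> 'b \<Rightarrow> 'b" +
  fixes leq :: "'b \<Rightarrow> 'b \<Rightarrow> bool"
  assumes le_refl: "x \<in> P \<Longrightarrow> leq x x"
    and le_antisym: "x \<in> P \<Longrightarrow> y \<in> P \<Longrightarrow> leq x y \<Longrightarrow> leq y x \<Longrightarrow> x = y"
    and le_trans: "x \<in> P \<Longrightarrow> y \<in> P \<Longrightarrow> z \<in> P \<Longrightarrow> leq x y \<Longrightarrow> leq y z \<Longrightarrow> leq x z"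
    and act_le_iff: "g \<in> carrier (integer_mod_group p) \<Longrightarrow> x \<in> P \<Longrightarrow> y \<in> P \<Longrightarrow>
          leq (\<phi> g x) (\<phi> g y) \<longleftrightarrow> leq x y"

locale free_Zp_poset = Zp_poset +
  assumes free: "g \<in> carrier (integer_mod_group p) \<Longrightarrow> g \<noteq> \<one>\<^bsub>integer_mod_group p\<^esub> \<Longrightarrow>
          x \<in> P \<Longrightarrow> \<phi> g x \<noteq> x"

definition Q_carrier :: "nat \<Rightarrow> nat \<Rightarrow> (int \<times> nat) set" where
  "Q_carrier n p = carrier (integer_mod_group p) \<times> {1..n + 1}"

definition Q_le :: "int \<times> nat \<Rightarrow> int \<times> nat \<Rightarrow> bool" where
  "Q_le x y \<longleftrightarrow> x = y \<or> snd x < snd y"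

definition Q_act :: "nat \<Rightarrow> nat \<Rightarrow> int \<Rightarrow> int \<times> nat \<Rightarrow> int \<times> nat" where
  "Q_act n p g = (\<lambda>x\<in>Q_carrier n p. (g \<otimes>\<^bsub>integer_mod_group p\<^esub> fst x, snd x))"

text \<open>The cross-index of the \<open>Zp_poset\<close> with carrier \<open>P\<close>, action \<open>\<phi>\<close> and order \<open>leq\<close>.\<close>

definition Xind :: "nat \<Rightarrow> 'b set \<Rightarrow> (int \<Rightarrow> 'b \<Rightarrow> 'b) \<Rightarrow> ('b \<Rightarrow> 'b \<Rightarrow> bool) \<Rightarrow> nat" where
  "Xind p P \<phi> leq = (LEAST n. \<exists>f \<in> P \<rightarrow> Q_carrier n p. monotone_on P leq Q_le f \<and>
     (\<forall>g\<in>carrier (integer_mod_group p). \<forall>x\<in>P. f (\<phi> g x) = Q_act n p g (f x)))"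

section \<open>Hom complexes\<close>

text \<open>A tuple of vertex sets \<open>U\<^sub>1, \<dots>, U\<^sub>p\<close> is a list of length \<open>p\<close>.\<close>

definition partite_sub :: "'a hgraph \<Rightarrow> 'a set list \<Rightarrow> 'a hgraph" where
  "partite_sub H Us = \<lparr>verts = \<Union>(set Us),
     edges = {e \<in> edges H. e \<subseteq> \<Union>(set Us) \<and> (\<forall>i<length Us. card (e \<inter> Us ! i) \<le> 1)}\<rparr>"

definition complete_partite :: "nat \<Rightarrow> 'a hgraph \<Rightarrow> 'a set list \<Rightarrow> bool" where
  "complete_partite r H Us \<longleftrightarrow>
     (\<forall>e. e \<subseteq> \<Union>(set Us) \<and> card e = r \<and> (\<forall>i<length Us. card (e \<inter> Us ! i) \<le> 1) \<longrightarrow>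
        e \<in> edges (partite_sub H Us))"

definition Hom_carrier :: "nat \<Rightarrow> nat \<Rightarrow> 'a hgraph \<Rightarrow> 'a set list set" where
  "Hom_carrier r p H = {Us. length Us = p \<and>
     (\<forall>i<p. Us ! i \<noteq> {} \<and> Us ! i \<subseteq> verts H) \<and>
     (\<forall>i<p. \<forall>j<p. i \<noteq> j \<longrightarrow> Us ! i \<inter> Us ! j = {}) \<and>
     complete_partite r H Us}"

definition Hom_le :: "'a set list \<Rightarrow> 'a set list \<Rightarrow> bool" where
  "Hom_le = list_all2 (\<subseteq>)"

text \<open>\<open>rotate i [U\<^sub>1, \<dots>, U\<^sub>p]\<close> is \<open>[U\<^bsub>1+i\<^esub>, \<dots>, U\<^bsub>p+i\<^esub>]\<close>, with indices modulo \<open>p\<close>.\<close>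

definition Hom_act :: "nat \<Rightarrow> nat \<Rightarrow> 'a hgraph \<Rightarrow> int \<Rightarrow> 'a set list \<Rightarrow> 'a set list" where
  "Hom_act r p H g = (\<lambda>Us\<in>Hom_carrier r p H. rotate (nat g) Us)"

abbreviation Xind_Hom :: "nat \<Rightarrow> nat \<Rightarrow> 'a hgraph \<Rightarrow> nat" where
  "Xind_Hom r p H \<equiv> Xind p (Hom_carrier r p H) (Hom_act r p H) Hom_le"


section \<open>The posets above are free cyclic group posets\<close>

lemma free_Zp_posetI:
  assumes p: "p > 0"
    and ext: "\<And>g. g \<in> {0..<int p} \<Longrightarrow> \<phi> g \<in> extensional P"
    and closed: "\<And>g x. g \<in> {0..<int p} \<Longrightarrow> x \<in> P \<Longrightarrow> \<phi> g x \<in> P"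
    and zero: "\<And>x. x \<in> P \<Longrightarrow> \<phi> 0 x = x"
    and add: "\<And>g h x. g \<in> {0..<int p} \<Longrightarrow> h \<in> {0..<int p} \<Longrightarrow> x \<in> P \<Longrightarrow>
                \<phi> ((g + h) mod int p) x = \<phi> g (\<phi> h x)"
    and refl: "\<And>x. x \<in> P \<Longrightarrow> leq x x"
    and antisym: "\<And>x y. x \<in> P \<Longrightarrow> y \<in> P \<Longrightarrow> leq x y \<Longrightarrow> leq y x \<Longrightarrow> x = y"
    and trans: "\<And>x y z. x \<in> P \<Longrightarrow> y \<in> P \<Longrightarrow> z \<in> P \<Longrightarrow> leq x y \<Longrightarrow> leq y z \<Longrightarrow> leq x z"
    and mono: "\<And>g x y. g \<in> {0..<int p} \<Longrightarrow> x \<in> P \<Longrightarrow> y \<in> P \<Longrightarrow> leq x y \<Longrightarrow>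
                leq (\<phi> g x) (\<phi> g y)"
    and free: "\<And>g x. g \<in> {0<..<int p} \<Longrightarrow> x \<in> P \<Longrightarrow> \<phi> g x \<noteq> x"
  shows "free_Zp_poset p P \<phi> leq"
proof -
  have carr: "carrier (integer_mod_group p) = {0..<int p}"
    using p by (simp add: carrier_integer_mod_group)
  have inv: "\<exists>h\<in>{0..<int p}. \<forall>x\<in>P. \<phi> h (\<phi> g x) = x \<and> \<phi> g (\<phi> h x) = x"
    if g: "g \<in> {0..<int p}" for g
  proof -
    define h where "h = (- g) mod int p"
    have h: "h \<in> {0..<int p}" using p by (simp add: h_def)
    have "(h + g) mod int p = 0" "(g + h) mod int p = 0"
      by (simp_all add: h_def mod_simps)
    with h g add zero show ?thesis by metis
  qed
  have Bij: "\<phi> g \<in> Bij P" if g: "g \<in> {0..<int p}" for g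
  proof -
    obtain h where h: "h \<in> {0..<int p}" "\<forall>x\<in>P. \<phi> h (\<phi> g x) = x \<and> \<phi> g (\<phi> h x) = x"
      using inv[OF g] by blast
    have "bij_betw (\<phi> g) P P"
      by (rule bij_betw_byWitness[where f' = "\<phi> h"]) (use h g closed in auto)
    with ext[OF g] show ?thesis by (simp add: Bij_def)
  qed
  have "group_hom (integer_mod_group p) (BijGroup P) \<phi>"
  proof (rule group_hom.intro)
    show "group_hom_axioms (integer_mod_group p) (BijGroup P) \<phi>"
    proof (rule group_hom_axioms.intro, rule homI)
      fix g assume "g \<in> carrier (integer_mod_group p)"
      then show "\<phi> g \<in> carrier (BijGroup P)"
        using Bij carr by (simp add: BijGroup_def)
    next
      fix g h assume "g \<in> carrier (integer_mod_group p)" "h \<in> carrier (integer_mod_group p)"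
      then have gh: "g \<in> {0..<int p}" "h \<in> {0..<int p}" using carr by auto
      then have "(g + h) mod int p \<in> {0..<int p}" using p by simp
      then have "\<phi> ((g + h) mod int p) = compose P (\<phi> g) (\<phi> h)"
        using gh by (intro extensionalityI[where A = P]) (auto simp: ext add compose_def)
      then show "\<phi> (g \<otimes>\<^bsub>integer_mod_group p\<^esub> h) = \<phi> g \<otimes>\<^bsub>BijGroup P\<^esub> \<phi> h"
        using gh Bij by (simp add: BijGroup_def)
    qed
  qed (simp_all add: group_BijGroup)
  moreover have "leq (\<phi> g x) (\<phi> g y) \<longleftrightarrow> leq x y"
    if "g \<in> {0..<int p}" "x \<in> P" "y \<in> P" for g x y
    using inv[OF that(1)] that mono closed by metis
  moreover have "\<phi> g x \<noteq> x" if "g \<in> {0..<int p}" "g \<noteq> 0" "x \<in> P" for g x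
    by (rule free) (use that in auto)
  ultimately show ?thesis
    by (intro free_Zp_poset.intro Zp_poset.intro group_action.intro Zp_poset_axioms.intro
        free_Zp_poset_axioms.intro)
      (simp_all only: carr one_integer_mod_group refl antisym, blast intro: trans)
qed

lemma free_Zp_poset_Q:
  assumes "p > 0"
  shows "free_Zp_poset p (Q_carrier n p) (Q_act n p) Q_le"
proof -
  have carr: "Q_carrier n p = {0..<int p} \<times> {1..n + 1}"
    using assms by (simp add: Q_carrier_def carrier_integer_mod_group)
  show ?thesis
  proof (rule free_Zp_posetI[OF assms])
    fix g x assume g: "g \<in> {0<..<int p}" and x: "x \<in> Q_carrier n p"
    obtain k j where [simp]: "x = (k, j)" by fastforce
    have k: "0 \<le> k" "k < int p" using x carr by auto
    have "(g + k) mod int p \<noteq> k"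
    proof
      assume "(g + k) mod int p = k"
      then have "(g + k) mod int p = k mod int p" using k by simp
      then have "int p dvd g" by (simp add: mod_eq_dvd_iff)
      then show False using g by (auto dest: zdvd_imp_le)
    qed
    then show "Q_act n p g x \<noteq> x" using x by (simp add: Q_act_def)
  qed (use assms in \<open>auto simp: Q_act_def Q_le_def carr mod_simps add.assoc\<close>)
qed

lemma rotate_in_Hom_carrier:
  assumes "p > 0" "Us \<in> Hom_carrier r p H"
  shows "rotate k Us \<in> Hom_carrier r p H"
proof -
  have len: "length Us = p" using assms by (simp add: Hom_carrier_def)
  have shift_inj: "i = j" if "i < p" "j < p" "(k + i) mod p = (k + j) mod p" for i j
  proof -
    have "(int k + int i) mod int p = (int k + int j) mod int p"
      using that(3) by (metis of_nat_add zmod_int)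
    then have "int p dvd int i - int j" by (simp add: mod_eq_dvd_iff)
    moreover have "\<bar>int i - int j\<bar> < int p" using that(1,2) by linarith
    ultimately show ?thesis using dvd_imp_le_int[of "int i - int j" "int p"] by force
  qed
  have all: "(\<forall>i<length (rotate k Us). card (e \<inter> rotate k Us ! i) \<le> 1) \<longleftrightarrow>
      (\<forall>i<length Us. card (e \<inter> Us ! i) \<le> 1)" for e
    using all_set_conv_all_nth[of "rotate k Us" "\<lambda>U. card (e \<inter> U) \<le> 1"]
      all_set_conv_all_nth[of Us "\<lambda>U. card (e \<inter> U) \<le> 1"] by simp
  have "complete_partite r H (rotate k Us) \<longleftrightarrow> complete_partite r H Us"
    unfolding complete_partite_def partite_sub_def by (simp only: all set_rotate)
  then have "complete_partite r H (rotate k Us)"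
    using assms(2) by (simp add: Hom_carrier_def)
  moreover have nth: "rotate k Us ! i = Us ! ((k + i) mod p)" if "i < p" for i
    using that len by (simp add: nth_rotate)
  have "rotate k Us ! i \<noteq> {} \<and> rotate k Us ! i \<subseteq> verts H" if "i < p" for i
    using assms nth[OF that] by (simp add: Hom_carrier_def)
  moreover have "rotate k Us ! i \<inter> rotate k Us ! j = {}" if "i < p" "j < p" "i \<noteq> j" for i j
  proof -
    have "(k + i) mod p \<noteq> (k + j) mod p" using shift_inj that by blast
    with assms nth that show ?thesis by (simp add: Hom_carrier_def)
  qed
  ultimately show ?thesis
    using len unfolding Hom_carrier_def by simp
qed

lemma free_Zp_poset_Hom:
  assumes "p > 0"
  shows "free_Zp_poset p (Hom_carrier r p H) (Hom_act r p H) Hom_le"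
proof (rule free_Zp_posetI[OF assms])
  fix g h Us assume gh: "g \<in> {0..<int p}" "h \<in> {0..<int p}" and Us: "Us \<in> Hom_carrier r p H"
  have len: "length Us = p" using Us by (simp add: Hom_carrier_def)
  have "nat ((g + h) mod int p) = (nat g + nat h) mod p"
    using gh by (simp add: nat_mod_distrib nat_add_distrib)
  then show "Hom_act r p H ((g + h) mod int p) Us = Hom_act r p H g (Hom_act r p H h Us)"
    using Us rotate_in_Hom_carrier[OF assms Us]
    by (simp add: Hom_act_def rotate_rotate len rotate_conv_mod[of "nat g + nat h" Us])
next
  fix g Us assume g: "g \<in> {0<..<int p}" and Us: "Us \<in> Hom_carrier r p H"
  have len: "length Us = p" using Us by (simp add: Hom_carrier_def)
  have g': "nat g < p" "nat g \<noteq> 0" using g by auto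
  then have "rotate (nat g) Us ! 0 = Us ! nat g"
    using len assms by (simp add: nth_rotate)
  moreover have "Us ! nat g \<noteq> Us ! 0"
    using Us g' assms unfolding Hom_carrier_def by fastforce
  ultimately have "rotate (nat g) Us \<noteq> Us" by metis
  then show "Hom_act r p H g Us \<noteq> Us"
    using Us by (simp add: Hom_act_def)
next
  fix x y z :: "'a set list" assume "Hom_le x y" "Hom_le y z"
  then show "Hom_le x z"
    unfolding Hom_le_def by (rule list_all2_trans[rotated]) auto
next
  fix x y :: "'a set list" assume "Hom_le x y" "Hom_le y x"
  then show "x = y"
    unfolding Hom_le_def by (rule list_all2_antisym[rotated]) auto
next
  fix g x y assume "x \<in> Hom_carrier r p H" "y \<in> Hom_carrier r p H" "Hom_le x y"
  then show "Hom_le (Hom_act r p H g x) (Hom_act r p H g y)"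
    by (simp add: Hom_act_def Hom_le_def list_all2_conv_all_nth nth_rotate Hom_carrier_def assms)
qed (auto simp: Hom_act_def Hom_le_def rotate_in_Hom_carrier[OF assms] list_all2_refl)

end

theory Submission
  imports Defs
begin

text \<open>
  Fix a proper coloring \<open>c\<close> and put \<open>A\<^sub>i = c(U\<^sub>i)\<close> for a tuple \<open>U\<close> in the Hom complex. A color
  lies in at most \<open>r - 1\<close> of the sets \<open>A\<^sub>i\<close>: picking one vertex of that color in each of \<open>r\<close> parts
  would give a monochromatic edge.

  The topological input is that some \<open>U\<close> has many colors in a balanced way. With
  \<open>m = min |A\<^sub>i|\<close>, measure \<open>U\<close> by \<open>\<ell>(U) = \<Sum>\<^sub>i min(|A\<^sub>i|, m + 1)\<close>, the largest total size of a
  tuple of subsets of the \<open>A\<^sub>i\<close> whose sizes differ by at most one. This is monotone and invariant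
  under rotation, so it can serve as the second coordinate of a map into \<open>Q\<^bsub>n,p\<^esub>\<close>. For the sign,
  replace each \<open>A\<^sub>i\<close> with more than \<open>m\<close> elements by the empty set. The resulting list only depends
  on the level along a chain (\<open>balanced_size_eq_imp\<close>), and it is not constant, since a color cannot
  lie in all \<open>p \<ge> r\<close> parts. As \<open>p\<close> is prime, its rotations are distinct, so an equivariant sign
  can be chosen orbit by orbit (\<open>exists_equivariant_sign\<close>). If \<open>\<ell>\<close> were below \<open>t\<close> everywhere, this
  map would contradict the value of the cross-index (\<open>exists_balanced_tuple\<close>).

  So some \<open>U\<close> has all \<open>|A\<^sub>i| \<ge> a\<close> and at least \<open>b\<close> of the \<open>A\<^sub>i\<close> larger than \<open>a\<close>. Keep \<open>p - r + 1\<close>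
  parts, preferring the large ones, and take one vertex from each of the other \<open>r - 1\<close> parts. By
  completeness every vertex of a kept part is a neighbor of this transversal. Counting with
  multiplicity at most \<open>r - 1\<close> bounds the number of colors on the kept parts from below. Either the
  transversal can be chosen to contribute one more color, or the kept parts already carry all the
  colors of \<open>U\<close>; these are the two terms of the minimum.
\<close>

section \<open>Rotations of lists of prime length\<close>

text \<open>The index \<open>k\<close> generates the cyclic group of prime order, so invariance under rotation by \<open>k\<close>
  already connects all positions.\<close>

lemma rotate_fixed_imp_constant:
  assumes p: "prime (length L)" and k: "0 < k" "k < length L" and rot: "rotate k L = L"
    and i: "i < length L"
  shows "L ! i = L ! 0"
proof -
  let ?p = "length L"
  have step: "L ! ((n * k) mod ?p) = L ! 0" for n
  proof (induction n)
    case (Suc n)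
    have lt: "(n * k) mod ?p < ?p" using i by (intro mod_less_divisor) linarith
    have "L ! ((n * k) mod ?p) = rotate k L ! ((n * k) mod ?p)" by (simp add: rot)
    also have "\<dots> = L ! ((k + (n * k) mod ?p) mod ?p)" by (rule nth_rotate[OF lt])
    also have "(k + (n * k) mod ?p) mod ?p = (Suc n * k) mod ?p" by (simp add: mod_simps)
    finally show ?case using Suc by simp
  qed simp
  have "coprime k ?p"
    using p k by (metis coprime_commute nat_dvd_not_less prime_imp_coprime)
  then obtain x y where xy: "k * x = ?p * y + 1"
    using bezout_nat[of k ?p] k by auto
  have "(i * x * k) mod ?p = (i * (k * x)) mod ?p" by (simp add: ac_simps)
  also have "\<dots> = (i + ?p * (i * y)) mod ?p" by (simp add: xy algebra_simps)
  also have "\<dots> = i" using i by simp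
  finally show ?thesis using step[of "i * x"] by simp
qed

lemma rotate_eq_imp_eq:
  assumes p: "prime (length L)" and nc: "\<not> (\<forall>i<length L. L ! i = L ! 0)"
    and jk: "j < length L" "k < length L" "rotate j L = rotate k L"
  shows "j = k"
proof -
  have aux: False if "j < k" "k < length L" "rotate j L = rotate k L" for j k
  proof -
    have "rotate (length L - j) (rotate k L) = rotate (length L - j) (rotate j L)"
      using that by simp
    also have "\<dots> = L" using less_trans[OF that(1,2)] by (simp add: rotate_rotate)
    finally have "rotate (length L - j + k) L = L" by (simp add: rotate_rotate)
    moreover have "length L - j + k = length L + (k - j)" using that by simp
    ultimately have "rotate (k - j) L = L"
      using rotate_conv_mod[of "length L + (k - j)" L] rotate_conv_mod[of "k - j" L] by simp
    then show False using rotate_fixed_imp_constant[OF p, of "k - j"] nc that by auto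
  qed
  show ?thesis using aux[of j k] aux[of k j] jk by (metis linorder_neqE_nat)
qed

text \<open>The rotation action on non-constant lists is free, so the sign of a list can be its position
  in its orbit relative to a chosen representative.\<close>

lemma exists_equivariant_sign:
  assumes p: "prime p"
  obtains s :: "'b list \<Rightarrow> nat" where
    "\<And>L g. length L = p \<Longrightarrow> \<not> (\<forall>i<p. L ! i = L ! 0) \<Longrightarrow>
      s L < p \<and> s (rotate g L) = (g + s L) mod p"
proof -
  have p0: "p > 0" using p by (simp add: prime_gt_0_nat)
  define orbit where "orbit L = range (\<lambda>i. rotate i L)" for L :: "'b list"
  define rep where "rep L = (SOME R. R \<in> orbit L)" for L :: "'b list"
  define s where "s L = (SOME k. k < p \<and> rotate k (rep L) = L)" for L :: "'b list"
  have orbit_rotate: "orbit (rotate g L) = orbit L" if "length L = p" for g and L :: "'b list"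
  proof -
    have "rotate i L = rotate (i + (p * g - g)) (rotate g L)" for i
    proof -
      have "g \<le> p * g" using p0 by simp
      then have "i + (p * g - g) + g = i + p * g" by linarith
      then have "rotate (i + (p * g - g)) (rotate g L) = rotate (i + p * g) L"
        by (simp only: rotate_rotate)
      also have "\<dots> = rotate i L"
        using rotate_conv_mod[of "i + p * g" L] rotate_conv_mod[of i L] that by simp
      finally show ?thesis ..
    qed
    then show ?thesis unfolding orbit_def by (auto simp: rotate_rotate)
  qed
  have rep: "\<exists>k<p. rotate k (rep L) = L" "length (rep L) = p" if "length L = p" for L :: "'b list"
  proof -
    have "L = rotate 0 L" by simp
    then have "L \<in> orbit L" unfolding orbit_def by blast
    then have R: "rep L \<in> orbit L" unfolding rep_def by (rule someI)
    then show len: "length (rep L) = p" using that by (auto simp: orbit_def)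
    obtain i where "rep L = rotate i L" using R by (auto simp: orbit_def)
    then have "orbit (rep L) = orbit L" by (simp add: orbit_rotate[OF that])
    then have "L \<in> orbit (rep L)" using \<open>L \<in> orbit L\<close> by simp
    then obtain k where k: "L = rotate k (rep L)" unfolding orbit_def by (rule rangeE)
    from k[symmetric] have "rotate (k mod p) (rep L) = L" using rotate_conv_mod[of k "rep L"] len by simp
    then show "\<exists>k<p. rotate k (rep L) = L" using p0 mod_less_divisor by blast
  qed
  have s: "s L < p \<and> rotate (s L) (rep L) = L" if "length L = p" for L
    unfolding s_def by (rule someI_ex) (use rep(1)[OF that] in blast)
  have eq: "s (rotate g L) = (g + s L) mod p"
    if L: "length L = p" and nc: "\<not> (\<forall>i<p. L ! i = L ! 0)" for L g
  proof -
    have rep_eq: "rep (rotate g L) = rep L" by (simp add: rep_def orbit_rotate[OF L])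
    have len: "length (rep L) = p" by (rule rep(2)[OF L])
    have "rotate (s (rotate g L)) (rep L) = rotate g L"
      using s[of "rotate g L"] L rep_eq by simp
    also have "\<dots> = rotate (g + s L) (rep L)" using s[OF L] by (simp flip: rotate_rotate)
    also have "\<dots> = rotate ((g + s L) mod p) (rep L)"
      using rotate_conv_mod[of "g + s L" "rep L"] len by simp
    finally have *: "rotate (s (rotate g L)) (rep L) = rotate ((g + s L) mod p) (rep L)" .
    have "\<not> (\<forall>i<p. rep L ! i = rep L ! 0)"
    proof
      assume const: "\<forall>i<p. rep L ! i = rep L ! 0"
      have "L ! i = rep L ! 0" if "i < p" for i
      proof -
        have "L ! i = rotate (s L) (rep L) ! i" using s[OF L] by simp
        also have "\<dots> = rep L ! ((s L + i) mod p)" using that len by (simp add: nth_rotate)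
        also have "\<dots> = rep L ! 0" using const p0 by (meson mod_less_divisor)
        finally show ?thesis .
      qed
      then show False using nc p0 by metis
    qed
    then show ?thesis
      by (intro rotate_eq_imp_eq[of "rep L"]) (use len p * s[of "rotate g L"] L p0 in auto)
  qed
  show thesis by (rule that[of s]) (use s eq in blast)
qed

section \<open>Balanced size of a tuple of sets\<close>

definition min_size :: "'b set list \<Rightarrow> nat" where
  "min_size A = Min (card ` set A)"

text \<open>The largest total size of subsets \<open>B\<^sub>i \<subseteq> A\<^sub>i\<close> whose sizes differ pairwise by at most one.\<close>

definition balanced_size :: "'b set list \<Rightarrow> nat" where
  "balanced_size A = (\<Sum>S\<leftarrow>A. min (card S) (min_size A + 1))"

text \<open>The parts above the minimal size may still grow along a chain of constant balanced size, so
  they are erased here; those of minimal size cannot.\<close>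

definition small_parts :: "'b set list \<Rightarrow> 'b set list" where
  "small_parts A = map (\<lambda>S. if card S = min_size A then S else {}) A"

lemma min_size_le: "i < length A \<Longrightarrow> min_size A \<le> card (A ! i)"
  by (simp add: min_size_def)

lemma min_size_attained:
  assumes "A \<noteq> []"
  obtains i where "i < length A" "card (A ! i) = min_size A"
proof -
  have "min_size A \<in> card ` set A" unfolding min_size_def using assms by (intro Min_in) auto
  then show thesis using that by (auto simp: in_set_conv_nth)
qed

lemma min_size_rotate [simp]: "min_size (rotate k A) = min_size A"
  by (simp add: min_size_def)

lemma balanced_size_rotate [simp]: "balanced_size (rotate k A) = balanced_size A"
proof -
  let ?f = "\<lambda>S. min (card S) (min_size A + 1)" and ?n = "k mod length A"
  have "balanced_size (rotate k A) = sum_list (map ?f (drop ?n A)) + sum_list (map ?f (take ?n A))"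
    unfolding balanced_size_def min_size_rotate by (simp add: rotate_drop_take)
  also have "\<dots> = sum_list (map ?f (take ?n A @ drop ?n A))"
    by (simp only: map_append sum_list_append add.commute)
  finally show ?thesis by (simp add: balanced_size_def)
qed

lemma small_parts_rotate: "small_parts (rotate k A) = rotate k (small_parts A)"
  by (simp add: small_parts_def rotate_map)

lemma length_small_parts [simp]: "length (small_parts A) = length A"
  by (simp add: small_parts_def)

lemma balanced_size_eq_sum:
  "balanced_size A = (\<Sum>i<length A. min (card (A ! i)) (min_size A + 1))"
  by (simp add: balanced_size_def sum_list_sum_nth atLeast0LessThan)

lemma min_size_mono:
  assumes "A \<noteq> []" and le: "list_all2 (\<subseteq>) A B" and fin: "\<And>S. S \<in> set B \<Longrightarrow> finite S"
  shows "min_size A \<le> min_size B"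
proof -
  have len: "length A = length B" using le by (rule list_all2_lengthD)
  then obtain i where i: "i < length B" "card (B ! i) = min_size B"
    using min_size_attained[of B] assms(1) by (metis length_0_conv)
  have "min_size A \<le> card (A ! i)" using i len by (simp add: min_size_le)
  also have "\<dots> \<le> card (B ! i)"
    using le i len fin by (intro card_mono) (auto simp: list_all2_conv_all_nth)
  finally show ?thesis using i by simp
qed

lemma balanced_size_mono:
  assumes "A \<noteq> []" and le: "list_all2 (\<subseteq>) A B" and fin: "\<And>S. S \<in> set B \<Longrightarrow> finite S"
  shows "balanced_size A \<le> balanced_size B"
proof -
  have len: "length A = length B" using le by (rule list_all2_lengthD)
  have "card (A ! i) \<le> card (B ! i)" if "i < length B" for i
    using le that len fin by (intro card_mono) (auto simp: list_all2_conv_all_nth)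
  then show ?thesis
    unfolding balanced_size_eq_sum len using min_size_mono[OF assms]
    by (intro sum_mono min.mono) auto
qed

text \<open>Equal totals force equal summands. The smallest summand is the minimal size, so this is the
  same on both sides, and then the parts of minimal size are the same; there the inclusion is an
  equality of sets.\<close>

lemma balanced_size_eq_imp:
  assumes "A \<noteq> []" and le: "list_all2 (\<subseteq>) A B" and fin: "\<And>S. S \<in> set B \<Longrightarrow> finite S"
    and eq: "balanced_size A = balanced_size B"
  shows "small_parts A = small_parts B"
proof -
  have len: "length A = length B" using le by (rule list_all2_lengthD)
  have sub: "A ! i \<subseteq> B ! i" and finB: "finite (B ! i)" if "i < length B" for i
    using le that fin by (auto simp: list_all2_conv_all_nth)
  have card_le: "card (A ! i) \<le> card (B ! i)" if "i < length B" for i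
    using sub[OF that] finB[OF that] by (rule card_mono[rotated])
  have min_le: "min_size A \<le> min_size B" by (rule min_size_mono) (use assms in auto)
  have le: "min (card (A ! i)) (min_size A + 1) \<le> min (card (B ! i)) (min_size B + 1)"
    if "i < length B" for i
    using card_le[OF that] min_le by (intro min.mono) auto
  have summand: "min (card (A ! i)) (min_size A + 1) = min (card (B ! i)) (min_size B + 1)"
    if i: "i < length B" for i
    by (rule sum_mono_inv[of "\<lambda>i. min (card (A ! i)) (min_size A + 1)" "{..<length B}"])
      (use eq i le in \<open>auto simp only: balanced_size_eq_sum len lessThan_iff finite_lessThan\<close>)
  obtain i where i: "i < length A" "card (A ! i) = min_size A"
    using min_size_attained[OF assms(1)] .
  have "min_size B \<le> min_size A"
    using summand[of i] i len min_size_le[of i B] by simp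
  with min_le have min_eq: "min_size A = min_size B" by simp
  have card_iff: "card (A ! i) = min_size B \<longleftrightarrow> card (B ! i) = min_size B"
    if "i < length B" for i
    using summand[OF that] min_size_le[OF that] min_size_le[of i A] that len min_eq by auto
  have "A ! i = B ! i" if "i < length B" "card (B ! i) = min_size B" for i
    using card_subset_eq[OF finB sub] card_iff that by simp
  then show ?thesis
    by (intro nth_equalityI) (auto simp: small_parts_def len min_eq card_iff)
qed

lemma length_le_balanced_size:
  assumes "\<And>i. i < length A \<Longrightarrow> finite (A ! i) \<and> A ! i \<noteq> {}"
  shows "length A \<le> balanced_size A"
proof -
  have "(\<Sum>i<length A. 1) \<le> balanced_size A"
    unfolding balanced_size_eq_sum
    by (intro sum_mono) (use assms in \<open>auto simp: Suc_le_eq card_gt_0_iff\<close>)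
  then show ?thesis by simp
qed

text \<open>The balanced size is \<open>p m + h\<close>, where \<open>m\<close> is the minimal size and \<open>h < p\<close> is the number of
  larger sets; compare this with \<open>a p + b\<close> as a division with remainder.\<close>

lemma balanced_sizeD:
  assumes ne: "A \<noteq> []" and ge: "a * length A + b \<le> balanced_size A" and b: "b < length A"
  shows "\<And>i. i < length A \<Longrightarrow> a \<le> card (A ! i)"
    and "b \<le> card {i. i < length A \<and> a < card (A ! i)}"
proof -
  let ?p = "length A" and ?m = "min_size A"
  define h where "h = card {i. i < ?p \<and> ?m < card (A ! i)}"
  have "balanced_size A = (\<Sum>i<?p. ?m + (if ?m < card (A ! i) then 1 else 0))"
    unfolding balanced_size_eq_sum by (intro sum.cong) (auto dest: min_size_le)
  also have "\<dots> = ?p * ?m + h"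
    by (simp add: sum.distrib h_def sum.If_cases lessThan_def Int_def)
  finally have bal: "balanced_size A = ?p * ?m + h" .
  obtain i0 where i0: "i0 < ?p" "card (A ! i0) = ?m" using min_size_attained[OF ne] .
  have "{i. i < ?p \<and> ?m < card (A ! i)} \<subseteq> {..<?p} - {i0}" using i0(2) by fastforce
  then have "h \<le> card ({..<?p} - {i0})" unfolding h_def by (intro card_mono) simp_all
  then have h: "h < ?p" using i0(1) by simp
  have am: "a \<le> ?m"
  proof (rule ccontr)
    assume "\<not> a \<le> ?m"
    then have "?p * (?m + 1) \<le> ?p * a" by (intro mult_le_mono) auto
    then show False using ge bal h by (simp add: algebra_simps)
  qed
  then show "a \<le> card (A ! i)" if "i < ?p" for i using min_size_le[OF that] by simp
  show "b \<le> card {i. i < ?p \<and> a < card (A ! i)}"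
  proof (cases "a = ?m")
    case True
    then show ?thesis using ge bal by (simp add: h_def mult.commute)
  next
    case False
    then have "{i. i < ?p \<and> a < card (A ! i)} = {..<?p}" using am min_size_le by fastforce
    then show ?thesis using b by simp
  qed
qed

section \<open>Tuples in the Hom complex\<close>

lemma transversal_is_edge:
  assumes Us: "Us \<in> Hom_carrier r p H" and J: "J \<subseteq> {..<p}" "card J = r"
    and x: "\<And>j. j \<in> J \<Longrightarrow> x j \<in> Us ! j"
  shows "x ` J \<in> edges H"
proof -
  have len: "length Us = p" and disj: "\<And>i j. i < p \<Longrightarrow> j < p \<Longrightarrow> i \<noteq> j \<Longrightarrow> Us ! i \<inter> Us ! j = {}"
    using Us by (auto simp: Hom_carrier_def)
  have inj: "inj_on x J"
  proof (rule inj_onI, rule ccontr)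
    fix i j assume "i \<in> J" "j \<in> J" "x i = x j" "i \<noteq> j"
    then show False using x[of i] x[of j] disj[of i j] J by auto
  qed
  have "card (x ` J \<inter> Us ! i) \<le> 1" if "i < p" for i
  proof -
    have "x ` J \<inter> Us ! i \<subseteq> {x i}"
    proof
      fix y assume "y \<in> x ` J \<inter> Us ! i"
      then obtain j where "j \<in> J" "y = x j" "x j \<in> Us ! i" by blast
      then show "y \<in> {x i}" using disj[of i j] x[of j] that J by blast
    qed
    then show ?thesis using card_mono[of "{x i}"] by simp
  qed
  moreover have "x ` J \<subseteq> \<Union>(set Us)" using x J len by (fastforce simp: in_set_conv_nth)
  moreover have "card (x ` J) = r" using card_image[OF inj] J by simp
  ultimately have "x ` J \<in> edges (partite_sub H Us)"
    using Us len by (simp add: Hom_carrier_def complete_partite_def)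
  then show ?thesis by (simp add: partite_sub_def)
qed

text \<open>Otherwise \<open>r\<close> vertices of color \<open>k\<close> in distinct parts would form a monochromatic edge.\<close>

lemma color_in_few_parts:
  assumes Us: "Us \<in> Hom_carrier r p H" and c: "proper_coloring H c" and r: "r > 0"
    and J: "J \<subseteq> {..<p}"
  shows "card {i \<in> J. k \<in> c ` (Us ! i)} \<le> r - 1"
proof (rule ccontr)
  assume "\<not> ?thesis"
  then have "r \<le> card {i \<in> J. k \<in> c ` (Us ! i)}" by simp
  then obtain I where I: "I \<subseteq> {i \<in> J. k \<in> c ` (Us ! i)}" "card I = r"
    using obtain_subset_with_card_n by metis
  then have "\<forall>i\<in>I. \<exists>v. v \<in> Us ! i \<and> c v = k" by auto
  then obtain x where x: "\<And>i. i \<in> I \<Longrightarrow> x i \<in> Us ! i \<and> c (x i) = k" by metis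
  have "x ` I \<in> edges H" by (rule transversal_is_edge[OF Us]) (use I J x in auto)
  then have "\<not> (\<exists>k. \<forall>v\<in>x ` I. c v = k)" using c unfolding proper_coloring_def by blast
  moreover have "\<forall>v\<in>x ` I. c v = k" using x by simp
  ultimately show False by blast
qed

text \<open>Count the pairs of a part and a color on it in two ways.\<close>

lemma sum_colors_le:
  assumes Us: "Us \<in> Hom_carrier r p H" and c: "proper_coloring H c" and r: "r > 0"
    and J: "J \<subseteq> {..<p}" and fin: "finite (verts H)"
  shows "(\<Sum>i\<in>J. card (c ` (Us ! i))) \<le> (r - 1) * card (\<Union>i\<in>J. c ` (Us ! i))"
proof -
  let ?C = "\<Union>i\<in>J. c ` (Us ! i)"
  have finJ: "finite J" using J finite_subset by blast
  have "finite (Us ! i)" if "i \<in> J" for i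
    using that J Us fin by (auto simp: Hom_carrier_def intro: finite_subset)
  then have finC: "finite ?C" using finJ by simp
  have "(\<Sum>i\<in>J. card (c ` (Us ! i))) = (\<Sum>i\<in>J. card {k \<in> ?C. k \<in> c ` (Us ! i)})"
    by (intro sum.cong arg_cong[where f = card]) auto
  also have "\<dots> = (\<Sum>k\<in>?C. card {i \<in> J. k \<in> c ` (Us ! i)})"
    by (rule sum_multicount_gen) (use finJ finC in auto)
  also have "\<dots> \<le> (\<Sum>k\<in>?C. r - 1)"
    by (intro sum_mono color_in_few_parts[OF Us c r J])
  finally show ?thesis by (simp add: mult.commute)
qed

text \<open>A clique on \<open>p\<close> vertices gives a tuple of singletons.\<close>

lemma Hom_carrier_nonempty:
  assumes H: "hypergraph H" and p: "p \<le> clique_number r H" and r: "r > 0"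
  shows "Hom_carrier r p H \<noteq> {}"
proof -
  let ?S = "{n. contains_copy H (complete_hgraph r n)}"
  have fin: "finite (verts H)" using H by (simp add: hypergraph_def)
  have "?S \<subseteq> {..card (verts H)}"
  proof
    fix n assume "n \<in> ?S"
    then obtain f where "inj_on f {1..n}" "f ` {1..n} \<subseteq> verts H"
      by (auto simp: contains_copy_def complete_hgraph_def)
    then show "n \<in> {..card (verts H)}" using card_inj_on_le[OF _ _ fin] by fastforce
  qed
  then have finS: "finite ?S" by (rule finite_subset) simp
  have "0 \<in> ?S"
    by (simp add: contains_copy_def complete_hgraph_def) (use r in auto)
  then have "clique_number r H \<in> ?S" unfolding clique_number_def using finS by (intro Max_in) auto
  then obtain f n where n: "p \<le> n" and inj: "inj_on f {1..n}" and sub: "f ` {1..n} \<subseteq> verts H"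
    and edge: "\<And>e. e \<subseteq> {1..n} \<Longrightarrow> card e = r \<Longrightarrow> f ` e \<in> edges H"
    using p by (auto simp: contains_copy_def complete_hgraph_def)
  define Us where "Us = map (\<lambda>i. {f (Suc i)}) [0..<p]"
  have nth: "Us ! i = {f (Suc i)}" if "i < p" for i using that by (simp add: Us_def)
  have f_eq: "f (Suc i) = f (Suc j) \<longleftrightarrow> i = j" if "i < p" "j < p" for i j
    using inj_on_eq_iff[OF inj, of "Suc i" "Suc j"] that n by auto
  have union: "\<Union>(set Us) \<subseteq> f ` {1..n}" using n by (auto simp: Us_def)
  have "e \<in> edges H" if "e \<subseteq> \<Union>(set Us)" "card e = r" for e
  proof -
    have "e \<subseteq> f ` {1..n}" using that(1) union by (rule subset_trans)
    then obtain e' where e': "e' \<subseteq> {1..n}" "e = f ` e'" by (auto simp: subset_image_iff)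
    then have "card e' = r" using that(2) card_image[OF inj_on_subset[OF inj e'(1)]] by simp
    then show ?thesis using edge e' by simp
  qed
  then have "complete_partite r H Us" by (simp add: complete_partite_def partite_sub_def)
  moreover have "f (Suc i) \<in> verts H" if "i < p" for i using sub that n by auto
  ultimately have "Us \<in> Hom_carrier r p H"
    unfolding Hom_carrier_def by (simp add: nth f_eq) (simp add: Us_def)
  then show ?thesis by blast
qed

text \<open>If all balanced sizes lay in \<open>{p..<Xind + p}\<close>, then the pair of sign and shifted balanced
  size would be an equivariant monotone map into \<open>Q\<close> with index one below the cross-index.\<close>

lemma exists_balanced_tuple:
  assumes H: "hypergraph H" and p: "prime p" and r: "r > 0" "r \<le> p"
    and clique: "p \<le> clique_number r H" and c: "proper_coloring H c"
  obtains Us where "Us \<in> Hom_carrier r p H"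
    and "Xind_Hom r p H + p \<le> balanced_size (map ((`) c) Us)"
proof -
  define P where "P = Hom_carrier r p H"
  define A where "A = map ((`) c)"
  have p0: "p > 0" using p by (simp add: prime_gt_0_nat)
  have len: "length Us = p" if "Us \<in> P" for Us using that by (simp add: P_def Hom_carrier_def)
  have parts: "finite (A Us ! i) \<and> A Us ! i \<noteq> {}" if "Us \<in> P" "i < p" for Us i
  proof -
    have "Us ! i \<noteq> {}" "Us ! i \<subseteq> verts H" using that by (auto simp: P_def Hom_carrier_def)
    moreover have "finite (verts H)" using H by (simp add: hypergraph_def)
    ultimately show ?thesis using len[OF that(1)] that(2) finite_subset by (auto simp: A_def)
  qed
  have p_le: "p \<le> balanced_size (A Us)" if "Us \<in> P" for Us
    using length_le_balanced_size[of "A Us"] len[OF that] parts[OF that] by (simp add: A_def)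
  have nonconst: "\<not> (\<forall>i<p. small_parts (A Us) ! i = small_parts (A Us) ! 0)" if Us: "Us \<in> P" for Us
  proof
    assume const: "\<forall>i<p. small_parts (A Us) ! i = small_parts (A Us) ! 0"
    have lenA: "length (A Us) = p" using len[OF Us] by (simp add: A_def)
    then obtain i where i: "i < p" "card (A Us ! i) = min_size (A Us)"
      using min_size_attained[of "A Us"] p0 by (metis length_greater_0_conv)
    obtain k where k: "k \<in> A Us ! i" using parts[OF Us i(1)] by blast
    have "k \<in> small_parts (A Us) ! i" using i k lenA by (simp add: small_parts_def)
    then have "k \<in> small_parts (A Us) ! j" if "j < p" for j using const i(1) that by metis
    then have "k \<in> A Us ! j" if "j < p" for j
      using that lenA by (fastforce simp: small_parts_def split: if_splits)
    then have "{j \<in> {..<p}. k \<in> c ` (Us ! j)} = {..<p}" using len[OF Us] by (auto simp: A_def)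
    then show False
      using color_in_few_parts[of Us r p H c "{..<p}" k] Us c r by (simp add: P_def)
  qed
  have "\<exists>Us\<in>P. Xind_Hom r p H + p \<le> balanced_size (A Us)"
  proof (cases "Xind_Hom r p H = 0")
    case True
    \<comment> \<open>There is no \<open>Q\<close> of index \<open>-1\<close> to map to, but any tuple has balanced size at least \<open>p\<close>.\<close>
    then show ?thesis using Hom_carrier_nonempty[OF H clique r(1)] p_le by (auto simp: P_def)
  next
    case False
    show ?thesis
    proof (rule ccontr)
      assume "\<not> ?thesis"
      then have less: "balanced_size (A Us) < Xind_Hom r p H + p" if "Us \<in> P" for Us
        using that by (meson not_le)
      define n where "n = Xind_Hom r p H - 1"
      obtain s :: "nat set list \<Rightarrow> nat" where s: "\<And>L g. length L = p \<Longrightarrow>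
          \<not> (\<forall>i<p. L ! i = L ! 0) \<Longrightarrow> s L < p \<and> s (rotate g L) = (g + s L) mod p"
        using exists_equivariant_sign[OF p] by metis
      define f where "f Us = (int (s (small_parts (A Us))), balanced_size (A Us) - p + 1)" for Us
      have carr: "carrier (integer_mod_group p) = {0..<int p}"
        using p0 by (simp add: carrier_integer_mod_group)
      have sA: "s (small_parts (A Us)) < p"
        "s (rotate g (small_parts (A Us))) = (g + s (small_parts (A Us))) mod p" if "Us \<in> P" for Us g
        using s[of "small_parts (A Us)"] nonconst[OF that] len[OF that] by (simp_all add: A_def)
      have fQ: "f Us \<in> Q_carrier n p" if "Us \<in> P" for Us
        using sA(1)[OF that] less[OF that] p_le[OF that] False
        by (simp add: f_def Q_carrier_def carr n_def)
      have "monotone_on P Hom_le Q_le f"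
      proof (rule monotone_onI)
        fix Us Vs assume UV: "Us \<in> P" "Vs \<in> P" "Hom_le Us Vs"
        have ne: "A Us \<noteq> []" using len[OF UV(1)] p0 by (auto simp: A_def)
        have le: "list_all2 (\<subseteq>) (A Us) (A Vs)"
          using UV(3) unfolding Hom_le_def A_def list_all2_map1 list_all2_map2
            by (rule list_all2_mono) (rule image_mono)
        have fin: "finite S" if "S \<in> set (A Vs)" for S
          using that parts[OF UV(2)] len[OF UV(2)] by (auto simp: in_set_conv_nth A_def)
        show "Q_le (f Us) (f Vs)"
        proof (cases "balanced_size (A Us) = balanced_size (A Vs)")
          case True
          then show ?thesis using balanced_size_eq_imp[OF ne le fin] by (simp add: f_def Q_le_def)
        next
          case False
          then have "balanced_size (A Us) < balanced_size (A Vs)"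
            using balanced_size_mono[OF ne le fin] by simp
          then show ?thesis using p_le[OF UV(1)] by (simp add: f_def Q_le_def diff_less_mono)
        qed
      qed
      moreover have "f (Hom_act r p H g Us) = Q_act n p g (f Us)"
        if g: "g \<in> carrier (integer_mod_group p)" and Us: "Us \<in> P" for g Us
      proof -
        have "A (Hom_act r p H g Us) = rotate (nat g) (A Us)"
          using Us by (simp add: Hom_act_def P_def A_def rotate_map)
        then have "f (Hom_act r p H g Us) =
            (int ((nat g + s (small_parts (A Us))) mod p), balanced_size (A Us) - p + 1)"
          by (simp add: f_def small_parts_rotate sA(2)[OF Us])
        also have "\<dots> = Q_act n p g (f Us)"
          using fQ[OF Us] g carr by (simp add: Q_act_def) (simp add: f_def zmod_int)
        finally show ?thesis .
      qed
      ultimately have "Xind_Hom r p H \<le> n"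
        unfolding Xind_def using fQ by (intro Least_le bexI[of _ f]) (auto simp: P_def)
      then show False using False by (simp add: n_def)
    qed
  qed
  then show thesis using that by (auto simp: P_def A_def)
qed

section \<open>Colors in a closed neighborhood\<close>

lemma max_local_colors_ge:
  assumes H: "hypergraph H" and e: "e \<in> edges H" "v \<in> e"
  shows "card (c ` closed_nbhd H (e - {v})) \<le> max_local_colors H c"
proof -
  have "finite (edges H)"
    using H by (auto simp: hypergraph_def intro: finite_subset[of _ "Pow (verts H)"])
  moreover have "finite e" if "e \<in> edges H" for e
    using H that by (auto simp: hypergraph_def intro: finite_subset)
  ultimately have "finite (\<Union>e\<in>edges H. (\<lambda>v. card (c ` closed_nbhd H (e - {v}))) ` e)" by blast
  then have "finite {card (c ` closed_nbhd H (e - {v})) | e v. e \<in> edges H \<and> v \<in> e}"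
    by (rule rev_finite_subset) blast
  then show ?thesis unfolding max_local_colors_def using e by (intro Max_ge) auto
qed

text \<open>Here \<open>J\<close> indexes the kept parts. If some color is missing on them, then the transversal of the
  other \<open>r - 1\<close> parts is chosen through a vertex with such a color.\<close>

lemma max_local_colors_lower_bound:
  assumes H: "hypergraph H" and r: "r > 0" "r \<le> p" and c: "proper_coloring H c"
    and Us: "Us \<in> Hom_carrier r p H" and J: "J \<subseteq> {..<p}" "card J = p - r + 1"
  shows "(\<Sum>i\<in>J. card (c ` (Us ! i))) + (r - 1) \<le> (r - 1) * max_local_colors H c \<or>
    (\<Sum>i<p. card (c ` (Us ! i))) \<le> (r - 1) * max_local_colors H c"
proof -
  let ?K = "max_local_colors H c"
  define C where "C = (\<Union>i\<in>J. c ` (Us ! i))"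
  define I where "I = {..<p} - J"
  have fin: "finite (verts H)" using H by (simp add: hypergraph_def)
  have finJ: "finite J" using J finite_subset by blast
  have cardI: "card I = r - 1" using J r by (simp add: I_def card_Diff_subset[OF finJ])
  have part: "Us ! i \<noteq> {}" "Us ! i \<subseteq> verts H" if "i < p" for i
    using Us that by (auto simp: Hom_carrier_def)
  have disj: "Us ! i \<inter> Us ! j = {}" if "i < p" "j < p" "i \<noteq> j" for i j
    using Us that by (auto simp: Hom_carrier_def)
  have finU: "finite (Us ! i)" if "i < p" for i using part(2)[OF that] fin finite_subset by blast
  have K: "card (C \<union> c ` x ` I) \<le> ?K" if x: "\<And>i. i < p \<Longrightarrow> x i \<in> Us ! i" for x
  proof -
    have edge: "insert v (x ` I) \<in> edges H \<and> v \<notin> x ` I" if v: "j \<in> J" "v \<in> Us ! j" for v j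
    proof
      have jI: "j \<notin> I" "j < p" "I \<subseteq> {..<p}" using v J by (auto simp: I_def)
      have "(x(j := v)) ` insert j I \<in> edges H"
      proof (rule transversal_is_edge[OF Us])
        show "card (insert j I) = r" using jI cardI r finite_subset[OF jI(3)] by simp
      qed (use jI v x in auto)
      moreover have "(x(j := v)) ` insert j I = insert v (x ` I)" using jI by auto
      ultimately show "insert v (x ` I) \<in> edges H" by simp
      show "v \<notin> x ` I"
      proof
        assume "v \<in> x ` I"
        then obtain i where "i \<in> I" "v = x i" by blast
        then show False using disj[of i j] x[of i] v jI by fastforce
      qed
    qed
    have "c ` (Us ! j) \<subseteq> c ` nbhd H (x ` I)" if "j \<in> J" for j
    proof (intro image_mono subsetI)
      fix v assume v: "v \<in> Us ! j"
      have "insert v (x ` I) - x ` I = {v}" using edge[OF that v] by auto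
      moreover have "v \<in> verts H" using v part(2)[of j] that J by auto
      ultimately show "v \<in> nbhd H (x ` I)" using edge[OF that v] by (auto simp: nbhd_def)
    qed
    then have "C \<subseteq> c ` nbhd H (x ` I)" unfolding C_def by (rule UN_least)
    then have sub: "C \<union> c ` x ` I \<subseteq> c ` closed_nbhd H (x ` I)"
      unfolding closed_nbhd_def image_Un by blast
    have "x ` I \<subseteq> verts H" using x part(2) by (fastforce simp: I_def)
    then have "finite (c ` closed_nbhd H (x ` I))"
      using fin by (auto simp: closed_nbhd_def nbhd_def intro: finite_subset)
    then have "card (C \<union> c ` x ` I) \<le> card (c ` closed_nbhd H (x ` I))"
      using sub by (rule card_mono)
    also have "\<dots> \<le> ?K"
    proof -
      have "J \<noteq> {}" using J(2) by auto
      then obtain j where j: "j \<in> J" by blast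
      then obtain v where v: "v \<in> Us ! j" using part(1)[of j] J by blast
      have "insert v (x ` I) - {v} = x ` I" using edge[OF j v] by auto
      then show ?thesis using max_local_colors_ge[OF H, of "insert v (x ` I)" v c] edge[OF j v] by simp
    qed
    finally show ?thesis .
  qed
  define x where "x i = (SOME v. v \<in> Us ! i)" for i
  have x: "x i \<in> Us ! i" if "i < p" for i
    unfolding x_def using part(1)[OF that] by (rule some_in_eq[THEN iffD2])
  have finC: "finite C" using finU J finJ by (auto simp: C_def)
  show ?thesis
  proof (cases "(\<Union>i<p. c ` (Us ! i)) \<subseteq> C")
    case True
    have "(\<Sum>i<p. card (c ` (Us ! i))) \<le> (r - 1) * card (\<Union>i<p. c ` (Us ! i))"
      by (rule sum_colors_le[OF Us c r(1) _ fin]) simp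
    also have "card (\<Union>i<p. c ` (Us ! i)) \<le> card C" by (rule card_mono[OF finC True])
    also have "card C \<le> card (C \<union> c ` x ` I)" using finC by (intro card_mono) (auto simp: I_def)
    also have "\<dots> \<le> ?K" by (rule K[OF x])
    finally show ?thesis by simp
  next
    case False
    then obtain i w where iw: "i < p" "w \<in> Us ! i" "c w \<notin> C" by auto
    then have iI: "i \<in> I" by (auto simp: I_def C_def)
    have "card C + 1 = card (insert (c w) C)" using finC iw by simp
    also have "\<dots> \<le> card (C \<union> c ` (x(i := w)) ` I)"
      using finC iI by (intro card_mono) (auto simp: I_def image_iff intro: bexI[of _ i])
    also have "\<dots> \<le> ?K" by (rule K) (use x iw in auto)
    finally have "(r - 1) * (card C + 1) \<le> (r - 1) * ?K" by (rule mult_le_mono2)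
    moreover have "(\<Sum>i\<in>J. card (c ` (Us ! i))) \<le> (r - 1) * card C"
      unfolding C_def by (rule sum_colors_le[OF Us c r(1) J(1) fin])
    ultimately show ?thesis by (simp add: distrib_left)
  qed
qed

section \<open>The lower bound for the local chromatic number\<close>

text \<open>Injective colorings are proper, so the infimum defining the local chromatic number is attained.\<close>

lemma local_chromatic_number_attained:
  assumes H: "hypergraph H" and r: "r \<ge> 2" "uniform r H"
  obtains c where "proper_coloring H c" "local_chromatic_number H = max_local_colors H c"
proof -
  have fin: "finite (verts H)" using H by (simp add: hypergraph_def)
  obtain c0 :: "'a \<Rightarrow> nat" where inj: "inj_on c0 (verts H)"
    using finite_imp_inj_to_nat_seg[OF fin] by blast
  have "\<not> (\<exists>k. \<forall>v\<in>e. c0 v = k)" if e: "e \<in> edges H" for e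
  proof
    assume "\<exists>k. \<forall>v\<in>e. c0 v = k"
    then obtain k where "c0 ` e \<subseteq> {k}" by blast
    then have "card (c0 ` e) \<le> 1" using card_mono[of "{k}"] by fastforce
    moreover have "inj_on c0 e" using inj e H by (auto simp: hypergraph_def intro: inj_on_subset)
    ultimately show False using e r by (simp add: card_image uniform_def)
  qed
  then have "{c. proper_coloring H c} \<noteq> {}" by (auto simp: proper_coloring_def)
  then have "local_chromatic_number H \<in> max_local_colors H ` {c. proper_coloring H c}"
    unfolding local_chromatic_number_def by (intro Inf_nat_def1) simp
  then show thesis using that by auto
qed

theorem theorem3:
  fixes H :: "'a hgraph" and r p t a b :: nat
  assumes "hypergraph H"
    and "r \<ge> 2"
    and "uniform r H"
    and "edges H \<noteq> {}"
    and "prime p"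
    and "r \<le> p"
    and "p \<le> clique_number r H"
    and "t = Xind_Hom r p H + p"
    and "t = a * p + b"
    and "b \<le> p - 1"
  shows "int (local_chromatic_number H) \<ge>
    min (\<lceil>((real p - real r + 1) * real a + min (real p - real r + 1) (real b)) / (real r - 1)\<rceil> + 1)
        \<lceil>real t / (real r - 1)\<rceil>"
proof -
  obtain c where c: "proper_coloring H c" and K: "local_chromatic_number H = max_local_colors H c"
    using local_chromatic_number_attained[OF assms(1-3)] .
  let ?K = "max_local_colors H c"
  have r0: "r > 0" and p0: "p > 0" using assms by auto
  obtain Us where Us: "Us \<in> Hom_carrier r p H" and bal: "t \<le> balanced_size (map ((`) c) Us)"
    using exists_balanced_tuple[OF assms(1,5) r0 assms(6,7) c] assms(8) by metis
  define w where "w i = card (c ` (Us ! i))" for i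
  have len: "length Us = p" using Us by (simp add: Hom_carrier_def)
  define B where "B = {i. i < p \<and> a < w i}"
  have ne: "map ((`) c) Us \<noteq> []" using len p0 by auto
  have "a * length (map ((`) c) Us) + b \<le> balanced_size (map ((`) c) Us)"
    "b < length (map ((`) c) Us)"
    using bal assms(9,10) len p0 by auto
  note balD = balanced_sizeD[OF ne this]
  have a: "a \<le> w i" if "i < p" for i using balD(1)[of i] that len by (simp add: w_def)
  have "{i. i < p \<and> a < card (map ((`) c) Us ! i)} = B"
    using len by (auto simp: B_def w_def)
  then have b: "b \<le> card B" using balD(2) len by simp
  define q where "q = p - r + 1"
  \<comment> \<open>Keep as many parts with more than \<open>a\<close> colors as are guaranteed and fit, then fill up.\<close>
  obtain B' where B': "B' \<subseteq> B" "card B' = min q b"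
    using obtain_subset_with_card_n[of "min q b" B] b by (metis min.coboundedI2)
  have "B' \<subseteq> {..<p}" using B' by (auto simp: B_def)
  moreover have "q \<le> p" using assms(6) r0 by (simp add: q_def)
  ultimately obtain J where J: "B' \<subseteq> J" "J \<subseteq> {..<p}" "card J = q"
    using exists_subset_between[of B' q "{..<p}"] B' by auto
  have sum_ge: "a * card S + card (S \<inter> T) \<le> sum w S" if "S \<subseteq> {..<p}" "T \<subseteq> B" for S T
  proof -
    have finS: "finite S" using that finite_subset by blast
    have "a * card S + card (S \<inter> T) = (\<Sum>i\<in>S. a + (if i \<in> T then 1 else 0))"
      using finS by (simp add: sum.distrib sum.If_cases mult.commute)
    also have "\<dots> \<le> sum w S"
      using that a by (intro sum_mono) (auto simp: B_def Suc_le_eq)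
    finally show ?thesis .
  qed
  have "J \<inter> B' = B'" using J by blast
  then have sumJ: "q * a + min q b \<le> sum w J"
    using sum_ge[OF J(2) B'(1)] J(3) B'(2) by (simp add: mult.commute)
  have "{..<p} \<inter> B = B" by (auto simp: B_def)
  then have sum_all: "t \<le> (\<Sum>i<p. w i)"
    using sum_ge[of "{..<p}" B] b assms(9) by (simp add: mult.commute)
  have rq: "real q = real p - real r + 1" "real (r - 1) = real r - 1" "real r - 1 > 0"
    using assms(2,6) by (auto simp: q_def of_nat_diff)
  from max_local_colors_lower_bound[OF assms(1) r0 assms(6) c Us J(2)] J(3)
  consider "sum w J + (r - 1) \<le> (r - 1) * ?K" | "(\<Sum>i<p. w i) \<le> (r - 1) * ?K"
    unfolding w_def q_def by blast
  then show ?thesis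
  proof cases
    case 1
    then have "q * a + min q b + (r - 1) \<le> (r - 1) * ?K" using sumJ by simp
    then have "real (q * a + min q b + (r - 1)) \<le> real ((r - 1) * ?K)" by (rule of_nat_mono)
    then have "real q * real a + min (real q) (real b) + (real r - 1) \<le> (real r - 1) * real ?K"
      by (simp only: of_nat_add of_nat_mult of_nat_min rq(2))
    then have "real q * real a + min (real q) (real b) \<le> (real r - 1) * (real ?K - 1)"
      by (simp add: right_diff_distrib)
    then have "(real q * real a + min (real q) (real b)) / (real r - 1) \<le> of_int (int ?K - 1)"
      using rq(3) by (simp add: pos_divide_le_eq mult.commute)
    then have "\<lceil>(real q * real a + min (real q) (real b)) / (real r - 1)\<rceil> \<le> int ?K - 1"
      by (simp only: ceiling_le_iff)
    then show ?thesis unfolding K rq(1) by linarith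
  next
    case 2
    then have "t \<le> (r - 1) * ?K" using sum_all by simp
    then have "real t \<le> real ((r - 1) * ?K)" by (rule of_nat_mono)
    then have "real t \<le> (real r - 1) * real ?K" by (simp only: of_nat_mult rq(2))
    then have "real t / (real r - 1) \<le> of_int (int ?K)"
      using rq(2,3) by (simp add: pos_divide_le_eq mult.commute)
    then have "\<lceil>real t / (real r - 1)\<rceil> \<le> int ?K" by (simp only: ceiling_le_iff)
    then show ?thesis unfolding K by linarith
  qed
qed

end
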